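(* For every $(\tau,\tau')\in\{132,213\}^2$, as formal power series in $z$, $$F(312,\tau;q,z)=1+\left(\frac{z}{1-z}\right)F(231,\tau';q,z).$$
   Context: $S_n$ is the set of permutations of $[n]=\{1,\ldots,n\}$ (with $S_0$ consisting of the empty permutation, which has no crossing). A permutation $\sigma\in S_n$ avoids a pattern $\tau\in S_m$ if no subsequence $\sigma(i_1)\cdots\sigma(i_m)$ with $i_1<\cdots<i_m$ is in the same relative order as $\tau$; $S_n(\tau_1,\tau_2)$ is the set of $\sigma\in S_n$ avoiding both $\tau_1$ and $\tau_2$. A crossing of $\sigma$ is a pair $(i,j)$ with $i<j<\sigma(i)<\sigma(j)$ or $\sigma(i)<\sigma(j)\leq i<j$; $\mathrm{cr}(\sigma)$ is the number of crossings. Put $$F(\tau_1,\tau_2;q,z)=\sum_{n\geq 0}\Big(\sum_{\sigma\in S_n(\tau_1,\tau_2)}q^{\mathrm{cr}(\sigma)}\Big)z^n.$$ *)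

theory Defs
  imports
    "HOL-Combinatorics.Permutations"
    "HOL-Computational_Algebra.Formal_Power_Series"
    "HOL-Computational_Algebra.Polynomial_Factorial"
begin

(* A pattern is given in one-line notation: its j-th letter is \<tau> ! (j - 1).
   The map p lists the positions of the subsequence; permutations of {1..n} are
   functions that are the identity outside {1..n}, so positions are confined to {1..n}. *)
definition contains_pattern :: "nat \<Rightarrow> (nat \<Rightarrow> nat) \<Rightarrow> nat list \<Rightarrow> bool" where
  "contains_pattern n \<sigma> \<tau> \<longleftrightarrow>
     (\<exists>p. strict_mono_on {..<length \<tau>} p \<and> p ` {..<length \<tau>} \<subseteq> {1..n} \<and>
          (\<forall>a<length \<tau>. \<forall>b<length \<tau>. \<sigma> (p a) < \<sigma> (p b) \<longleftrightarrow> \<tau> ! a < \<tau> ! b))"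

definition avoiders :: "nat \<Rightarrow> nat list \<Rightarrow> nat list \<Rightarrow> (nat \<Rightarrow> nat) set" where
  "avoiders n \<tau>\<^sub>1 \<tau>\<^sub>2 =
     {\<sigma>. \<sigma> permutes {1..n} \<and> \<not> contains_pattern n \<sigma> \<tau>\<^sub>1 \<and> \<not> contains_pattern n \<sigma> \<tau>\<^sub>2}"

definition crossings :: "nat \<Rightarrow> (nat \<Rightarrow> nat) \<Rightarrow> (nat \<times> nat) set" where
  "crossings n \<sigma> =
     {(i, j). i \<in> {1..n} \<and> j \<in> {1..n} \<and>
        (i < j \<and> j < \<sigma> i \<and> \<sigma> i < \<sigma> j \<or> \<sigma> i < \<sigma> j \<and> \<sigma> j \<le> i \<and> i < j)}"

definition cr :: "nat \<Rightarrow> (nat \<Rightarrow> nat) \<Rightarrow> nat" where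
  "cr n \<sigma> = card (crossings n \<sigma>)"

definition crossing_poly :: "nat \<Rightarrow> nat list \<Rightarrow> nat list \<Rightarrow> int poly" where
  "crossing_poly n \<tau>\<^sub>1 \<tau>\<^sub>2 = (\<Sum>\<sigma>\<in>avoiders n \<tau>\<^sub>1 \<tau>\<^sub>2. monom 1 (cr n \<sigma>))"

(* The indeterminate of int poly is q, and fps_X is z. The coefficients, polynomials
   in q over the integers, are embedded into the fraction field because division of
   formal power series, as in z / (1 - z), needs coefficients with an inverse. *)
definition crossing_gf :: "nat list \<Rightarrow> nat list \<Rightarrow> int poly fract fps" where
  "crossing_gf \<tau>\<^sub>1 \<tau>\<^sub>2 = Abs_fps (\<lambda>n. to_fract (crossing_poly n \<tau>\<^sub>1 \<tau>\<^sub>2))"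

end

theory Submission
  imports Defs
begin

text \<open>
  Write \<open>a\<^sub>n\<close> and \<open>b\<^sub>n\<close> for the crossing polynomials of \<open>S\<^sub>n(312,132)\<close> and \<open>S\<^sub>n(231,132)\<close>.
  If \<open>\<sigma>\<close> avoids 312 and 132, its last letter cannot lie strictly between two others, so it is
  the smallest or the largest letter. A largest last letter is a fixed point and may be deleted.
  If \<open>\<sigma>(n+1) = 1\<close>, then \<open>\<sigma>(i) = \<pi>(i) + 1\<close> for some permutation \<open>\<pi>\<close>; raising the values by one
  makes the strict inequality of upper crossings weak and the weak one of lower crossings strict,
  and inversion exchanges the two kinds, so \<open>\<sigma>\<close> has as many crossings as \<open>\<pi>\<^sup>-\<^sup>1\<close>, which avoids
  231 and 132. Hence \<open>a\<^sub>n\<^sub>+\<^sub>1 = a\<^sub>n + b\<^sub>n\<close> for positive \<open>n\<close>, and \<open>a\<^sub>1 = b\<^sub>0\<close>.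
  The reverse-complement-inverse preserves crossings, fixes 312 and 231 and exchanges 132 and 213.
\<close>

section \<open>Occurrences of patterns of length three\<close>

lemma contains_pattern_length3:
  "contains_pattern n \<sigma> [x, y, z] \<longleftrightarrow>
    (\<exists>i j k. 1 \<le> i \<and> i < j \<and> j < k \<and> k \<le> n \<and>
       (\<forall>a<3. \<forall>b<3. \<sigma> ([i, j, k] ! a) < \<sigma> ([i, j, k] ! b) \<longleftrightarrow> [x, y, z] ! a < [x, y, z] ! b))"
  (is "?L \<longleftrightarrow> ?R")
proof
  assume ?L
  then obtain p where p: "strict_mono_on {..<3} p" "p ` {..<3} \<subseteq> {1..n}"
    and o: "\<forall>a<3. \<forall>b<3. \<sigma> (p a) < \<sigma> (p b) \<longleftrightarrow> [x, y, z] ! a < [x, y, z] ! b"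
    by (auto simp: contains_pattern_def numeral_3_eq_3)
  have "[p 0, p 1, p 2] ! a = p a" if "a < 3" for a
    using that by (auto simp: numeral_3_eq_3 less_Suc_eq numeral_2_eq_2)
  moreover have "p 0 < p 1" "p 1 < p 2"
    using p(1) by (auto simp: strict_mono_on_def)
  moreover have "1 \<le> p 0" "p 2 \<le> n"
    using subsetD[OF p(2) imageI, of 0] subsetD[OF p(2) imageI, of 2] by simp_all
  ultimately show ?R
    using o by (intro exI[of _ "p 0"] exI[of _ "p 1"] exI[of _ "p 2"]) (simp del: One_nat_def)
next
  assume ?R
  then obtain i j k where ijk: "1 \<le> i" "i < j" "j < k" "k \<le> n"
    and o: "\<forall>a<3. \<forall>b<3. \<sigma> ([i, j, k] ! a) < \<sigma> ([i, j, k] ! b) \<longleftrightarrow> [x, y, z] ! a < [x, y, z] ! b"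
    by blast
  have "strict_mono_on {..<3} (\<lambda>a. [i, j, k] ! a)"
    using ijk by (auto simp: strict_mono_on_def numeral_3_eq_3 less_Suc_eq)
  moreover have "(\<lambda>a. [i, j, k] ! a) ` {..<3} \<subseteq> {1..n}"
    using ijk by (auto simp: numeral_3_eq_3 less_Suc_eq)
  ultimately show ?L
    using o unfolding contains_pattern_def
    by (intro exI[of _ "\<lambda>a. [i, j, k] ! a"]) (simp add: numeral_3_eq_3)
qed

text \<open>For a concrete pattern the nine comparisons of letters collapse to a chain of two strict
  inequalities; likewise for the next three patterns.\<close>

lemma contains_312:
  "contains_pattern n \<sigma> [3, 1, 2] \<longleftrightarrow>
    (\<exists>i j k. 1 \<le> i \<and> i < j \<and> j < k \<and> k \<le> n \<and> \<sigma> j < \<sigma> k \<and> \<sigma> k < \<sigma> i)"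
  unfolding contains_pattern_length3
  by (intro ex_cong1) (auto simp: numeral_3_eq_3 All_less_Suc)

lemma contains_231:
  "contains_pattern n \<sigma> [2, 3, 1] \<longleftrightarrow>
    (\<exists>i j k. 1 \<le> i \<and> i < j \<and> j < k \<and> k \<le> n \<and> \<sigma> k < \<sigma> i \<and> \<sigma> i < \<sigma> j)"
  unfolding contains_pattern_length3
  by (intro ex_cong1) (auto simp: numeral_3_eq_3 All_less_Suc)

lemma contains_132:
  "contains_pattern n \<sigma> [1, 3, 2] \<longleftrightarrow>
    (\<exists>i j k. 1 \<le> i \<and> i < j \<and> j < k \<and> k \<le> n \<and> \<sigma> i < \<sigma> k \<and> \<sigma> k < \<sigma> j)"
  unfolding contains_pattern_length3
  by (intro ex_cong1) (auto simp: numeral_3_eq_3 All_less_Suc)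

lemma contains_213:
  "contains_pattern n \<sigma> [2, 1, 3] \<longleftrightarrow>
    (\<exists>i j k. 1 \<le> i \<and> i < j \<and> j < k \<and> k \<le> n \<and> \<sigma> j < \<sigma> i \<and> \<sigma> i < \<sigma> k)"
  unfolding contains_pattern_length3
  by (intro ex_cong1) (auto simp: numeral_3_eq_3 All_less_Suc)

lemmas contains_simps = contains_312 contains_231 contains_132 contains_213

text \<open>Since 0 and all numbers above \<open>n\<close> are fixed, the equivalences hold for
  every \<open>i\<close>, so range conditions on positions simplify without side conditions.\<close>

lemma permutes_le_iff:
  fixes \<sigma> :: "nat \<Rightarrow> nat"
  assumes "\<sigma> permutes {1..n}"
  shows "Suc 0 \<le> \<sigma> i \<longleftrightarrow> Suc 0 \<le> i" "\<sigma> i \<le> n \<longleftrightarrow> i \<le> n"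
  using permutes_in_image[OF assms, of i] permutes_not_in[OF assms, of i]
  by (cases "i \<in> {1..n}"; auto)+

lemma finite_avoiders [simp]: "finite (avoiders n \<tau>\<^sub>1 \<tau>\<^sub>2)"
  by (rule finite_subset[OF _ finite_permutations[of "{1..n}"]]) (auto simp: avoiders_def)

subsection \<open>Inversion\<close>

text \<open>Inversion exchanges positions and values. As patterns, 231 and 312 are inverse to each
  other and 132 is an involution, so an occurrence in \<open>inv \<pi>\<close> turns into one in
  \<open>\<pi>\<close> once its positions are sorted by value.\<close>

lemma avoiders_inv_imp:
  assumes "\<pi> \<in> avoiders n [3, 1, 2] [1, 3, 2]"
  shows "inv \<pi> \<in> avoiders n [2, 3, 1] [1, 3, 2]"
proof -
  from assms have p: "\<pi> permutes {1..n}"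
    and a: "\<not> contains_pattern n \<pi> [3, 1, 2]" "\<not> contains_pattern n \<pi> [1, 3, 2]"
    by (auto simp: avoiders_def)
  note q = permutes_inv[OF p]
  note s = permutes_inverses[OF p] permutes_le_iff[OF q]
  have "\<not> contains_pattern n (inv \<pi>) [2, 3, 1]"
  proof
    assume "contains_pattern n (inv \<pi>) [2, 3, 1]"
    then obtain i j k where *: "1 \<le> i" "i < j" "j < k" "k \<le> n"
      "inv \<pi> k < inv \<pi> i" "inv \<pi> i < inv \<pi> j" unfolding contains_simps by blast
    then have "contains_pattern n \<pi> [3, 1, 2]" unfolding contains_simps
      by (intro exI[of _ "inv \<pi> k"] exI[of _ "inv \<pi> i"] exI[of _ "inv \<pi> j"]) (simp add: s)
    with a show False by blast
  qed
  moreover have "\<not> contains_pattern n (inv \<pi>) [1, 3, 2]"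
  proof
    assume "contains_pattern n (inv \<pi>) [1, 3, 2]"
    then obtain i j k where *: "1 \<le> i" "i < j" "j < k" "k \<le> n"
      "inv \<pi> i < inv \<pi> k" "inv \<pi> k < inv \<pi> j" unfolding contains_simps by blast
    then have "contains_pattern n \<pi> [1, 3, 2]" unfolding contains_simps
      by (intro exI[of _ "inv \<pi> i"] exI[of _ "inv \<pi> k"] exI[of _ "inv \<pi> j"]) (simp add: s)
    with a show False by blast
  qed
  ultimately show ?thesis using q by (simp add: avoiders_def)
qed

lemma inv_avoiders_imp:
  assumes "\<pi> \<in> avoiders n [2, 3, 1] [1, 3, 2]"
  shows "inv \<pi> \<in> avoiders n [3, 1, 2] [1, 3, 2]"
proof -
  from assms have p: "\<pi> permutes {1..n}"
    and a: "\<not> contains_pattern n \<pi> [2, 3, 1]" "\<not> contains_pattern n \<pi> [1, 3, 2]"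
    by (auto simp: avoiders_def)
  note q = permutes_inv[OF p]
  note s = permutes_inverses[OF p] permutes_le_iff[OF q]
  have "\<not> contains_pattern n (inv \<pi>) [3, 1, 2]"
  proof
    assume "contains_pattern n (inv \<pi>) [3, 1, 2]"
    then obtain i j k where *: "1 \<le> i" "i < j" "j < k" "k \<le> n"
      "inv \<pi> j < inv \<pi> k" "inv \<pi> k < inv \<pi> i" unfolding contains_simps by blast
    then have "contains_pattern n \<pi> [2, 3, 1]" unfolding contains_simps
      by (intro exI[of _ "inv \<pi> j"] exI[of _ "inv \<pi> k"] exI[of _ "inv \<pi> i"]) (simp add: s)
    with a show False by blast
  qed
  moreover have "\<not> contains_pattern n (inv \<pi>) [1, 3, 2]"
  proof
    assume "contains_pattern n (inv \<pi>) [1, 3, 2]"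
    then obtain i j k where *: "1 \<le> i" "i < j" "j < k" "k \<le> n"
      "inv \<pi> i < inv \<pi> k" "inv \<pi> k < inv \<pi> j" unfolding contains_simps by blast
    then have "contains_pattern n \<pi> [1, 3, 2]" unfolding contains_simps
      by (intro exI[of _ "inv \<pi> i"] exI[of _ "inv \<pi> k"] exI[of _ "inv \<pi> j"]) (simp add: s)
    with a show False by blast
  qed
  ultimately show ?thesis using q by (simp add: avoiders_def)
qed

text \<open>This moves the sum to the 312- and 132-avoiders, the index set of the other polynomial,
  where \<open>cr_cyc\<close> supplies the same summand.\<close>

lemma crossing_poly_231_132_inv:
  "crossing_poly n [2, 3, 1] [1, 3, 2] =
    (\<Sum>\<pi>\<in>avoiders n [3, 1, 2] [1, 3, 2]. monom 1 (cr n (inv \<pi>)))"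
  unfolding crossing_poly_def
proof (rule sum.reindex_bij_witness[of _ inv inv])
  show "inv (inv \<pi>) = \<pi>" if "\<pi> \<in> avoiders n [2, 3, 1] [1, 3, 2]" for \<pi>
    using that by (auto simp: avoiders_def intro: permutes_inv_inv)
  then show "monom 1 (cr n (inv (inv \<pi>))) = monom 1 (cr n \<pi>)"
    if "\<pi> \<in> avoiders n [2, 3, 1] [1, 3, 2]" for \<pi>
    using that by simp
  show "inv (inv \<pi>) = \<pi>" if "\<pi> \<in> avoiders n [3, 1, 2] [1, 3, 2]" for \<pi>
    using that by (auto simp: avoiders_def intro: permutes_inv_inv)
qed (use avoiders_inv_imp inv_avoiders_imp in auto)

subsection \<open>Raising the values by one\<close>

text \<open>The cycle 1, 2, ..., \<open>n + 1\<close>. A permutation of \<open>{1..n}\<close> fixes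
  \<open>n + 1\<close>, so composing with \<open>cyc n\<close> on the left raises its letters by one
  and appends the letter 1.\<close>

definition cyc :: "nat \<Rightarrow> nat \<Rightarrow> nat" where
  "cyc n i = (if i = Suc n then 1 else if i \<in> {1..n} then Suc i else i)"

lemma cyc_permutes: "cyc n permutes {1..Suc n}"
  by (rule inj_imp_permutes) (auto simp: inj_on_def cyc_def split: if_splits)

lemma cyc_permutes_iff:
  "\<sigma> permutes {1..Suc n} \<and> \<sigma> (Suc n) = 1 \<longleftrightarrow> (\<exists>\<pi>. \<pi> permutes {1..n} \<and> \<sigma> = cyc n \<circ> \<pi>)"
  (is "?L \<longleftrightarrow> ?R")
proof
  assume L: ?L
  let ?\<pi> = "inv (cyc n) \<circ> \<sigma>"
  have "?\<pi> permutes {1..Suc n}"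
    using L by (intro permutes_compose permutes_inv cyc_permutes) auto
  moreover have "?\<pi> (Suc n) = Suc n"
    using L permutes_inverses(2)[OF cyc_permutes, of n "Suc n"] by (simp add: cyc_def)
  ultimately have "?\<pi> permutes {1..n}"
    by (elim permutes_superset) (auto simp: le_Suc_eq)
  moreover have "\<sigma> = cyc n \<circ> ?\<pi>"
    using permutes_inverses(1)[OF cyc_permutes] by (auto simp: fun_eq_iff)
  ultimately show ?R by blast
next
  assume ?R
  then obtain \<pi> where p: "\<pi> permutes {1..n}" and s: "\<sigma> = cyc n \<circ> \<pi>" by blast
  then have "\<pi> permutes {1..Suc n}" by (elim permutes_subset) auto
  then show ?L
    using s permutes_not_in[OF p, of "Suc n"]
    by (simp add: permutes_compose[OF _ cyc_permutes, simplified] cyc_def)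
qed

lemma cyc_permutes_simps:
  assumes "\<pi> permutes {1..n}"
  shows "i \<in> {1..n} \<Longrightarrow> cyc n (\<pi> i) = Suc (\<pi> i)" "cyc n (\<pi> (Suc n)) = 1"
  using permutes_in_image[OF assms, of i] permutes_not_in[OF assms, of "Suc n"]
  by (auto simp: cyc_def)

lemma cr_cyc:
  assumes "\<pi> permutes {1..n}"
  shows "cr (Suc n) (cyc n \<circ> \<pi>) = cr n (inv \<pi>)"
proof -
  note q = permutes_inv[OF assms]
  note s = permutes_inverses[OF assms] permutes_le_iff[OF q] permutes_le_iff[OF assms]
  have c: "crossings (Suc n) (cyc n \<circ> \<pi>) =
     {(i, j). i \<in> {1..n} \<and> j \<in> {1..n} \<and>
        (i < j \<and> j \<le> \<pi> i \<and> \<pi> i < \<pi> j \<or> \<pi> i < \<pi> j \<and> \<pi> j < i \<and> i < j)}" (is "_ = ?C")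
  proof -
    note cyc = cyc_permutes_simps[OF assms]
    have "(i, j) \<in> crossings (Suc n) (cyc n \<circ> \<pi>) \<longleftrightarrow> (i, j) \<in> ?C" for i j
    proof (cases "i \<in> {1..n} \<and> j \<in> {1..n}")
      case True
      then show ?thesis
        using cyc(1)[of i] cyc(1)[of j] by (auto simp: crossings_def)
    next
      case False
      \<comment> \<open>A crossing needs the later position to carry the larger value, which the
        value 1 at \<open>n + 1\<close> rules out; and no position follows
        \<open>n + 1\<close>.\<close>
      have "\<not> (i, Suc n) \<in> crossings (Suc n) (cyc n \<circ> \<pi>)"
        using cyc(1)[of i] cyc(2) by (auto simp: crossings_def)
      then have "(i, j) \<notin> crossings (Suc n) (cyc n \<circ> \<pi>)"
        using False by (cases "j = Suc n") (auto simp: crossings_def)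
      with False show ?thesis by auto
    qed
    then show ?thesis by (intro set_eqI) (auto simp only: split_paired_all)
  qed
  \<comment> \<open>With a = \<pi> i and b = \<pi> j, the first alternative of \<open>?C\<close>
    becomes a lower crossing of \<open>inv \<pi>\<close> at (a, b), and the second an upper
    one.\<close>
  have "bij_betw (\<lambda>(i, j). (\<pi> i, \<pi> j)) ?C (crossings n (inv \<pi>))"
    by (rule bij_betw_byWitness[where f' = "\<lambda>(i, j). (inv \<pi> i, inv \<pi> j)"])
      (auto simp: crossings_def s)
  then show ?thesis
    unfolding cr_def c by (rule bij_betw_same_card)
qed

lemma avoiders_cyc:
  "{\<sigma> \<in> avoiders (Suc n) [3, 1, 2] [1, 3, 2]. \<sigma> (Suc n) = 1}
    = (\<lambda>\<pi>. cyc n \<circ> \<pi>) ` avoiders n [3, 1, 2] [1, 3, 2]"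
proof -
  \<comment> \<open>Position \<open>n + 1\<close> could only serve as the last letter of an
    occurrence. Both patterns end in their middle letter, which the minimum 1 cannot play; the other
    letters keep their relative order.\<close>
  have "contains_pattern (Suc n) (cyc n \<circ> \<pi>) \<tau> \<longleftrightarrow> contains_pattern n \<pi> \<tau>"
    if p: "\<pi> permutes {1..n}" and t: "\<tau> \<in> {[3, 1, 2], [1, 3, 2]}" for \<pi> \<tau>
  proof -
    have c: "cyc n (\<pi> i) = (if i = Suc n then 1 else Suc (\<pi> i))" if "1 \<le> i" "i \<le> Suc n" for i
      using that cyc_permutes_simps[OF p] by (cases "i = Suc n") auto
    have "\<tau> = [3, 1, 2] \<or> \<tau> = [1, 3, 2]" using t by simp
    then show ?thesis
    proof
      assume t: "\<tau> = [3, 1, 2]"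
      show ?thesis unfolding t contains_simps
        by (intro ex_cong1) (use c in \<open>auto simp: le_Suc_eq\<close>)
    next
      assume t: "\<tau> = [1, 3, 2]"
      show ?thesis unfolding t contains_simps
        by (intro ex_cong1) (use c in \<open>auto simp: le_Suc_eq\<close>)
    qed
  qed
  then have mem: "cyc n \<circ> \<pi> \<in> avoiders (Suc n) [3, 1, 2] [1, 3, 2] \<longleftrightarrow> \<pi> \<in> avoiders n [3, 1, 2] [1, 3, 2]"
    if "\<pi> permutes {1..n}" for \<pi>
    using that cyc_permutes_iff[of "cyc n \<circ> \<pi>" n] unfolding avoiders_def mem_Collect_eq by blast
  have perm: "\<sigma> permutes {1..m}" if "\<sigma> \<in> avoiders m \<tau>\<^sub>1 \<tau>\<^sub>2" for \<sigma> m \<tau>\<^sub>1 \<tau>\<^sub>2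
    using that by (simp add: avoiders_def)
  show ?thesis
  proof (intro subset_antisym subsetI)
    fix \<sigma> assume "\<sigma> \<in> {\<sigma> \<in> avoiders (Suc n) [3, 1, 2] [1, 3, 2]. \<sigma> (Suc n) = 1}"
    then have s: "\<sigma> \<in> avoiders (Suc n) [3, 1, 2] [1, 3, 2]" "\<sigma> (Suc n) = 1" by auto
    then obtain \<pi> where "\<pi> permutes {1..n}" "\<sigma> = cyc n \<circ> \<pi>"
      using perm cyc_permutes_iff[of \<sigma> n] by metis
    with s mem show "\<sigma> \<in> (\<lambda>\<pi>. cyc n \<circ> \<pi>) ` avoiders n [3, 1, 2] [1, 3, 2]" by blast
  next
    fix \<sigma> assume "\<sigma> \<in> (\<lambda>\<pi>. cyc n \<circ> \<pi>) ` avoiders n [3, 1, 2] [1, 3, 2]"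
    then obtain \<pi> where p: "\<pi> \<in> avoiders n [3, 1, 2] [1, 3, 2]" "\<sigma> = cyc n \<circ> \<pi>" by blast
    with perm mem have "\<sigma> \<in> avoiders (Suc n) [3, 1, 2] [1, 3, 2]" by blast
    moreover have "\<sigma> (Suc n) = 1"
      using p perm cyc_permutes_iff[of \<sigma> n] by metis
    ultimately show "\<sigma> \<in> {\<sigma> \<in> avoiders (Suc n) [3, 1, 2] [1, 3, 2]. \<sigma> (Suc n) = 1}" by simp
  qed
qed

subsection \<open>The recurrence\<close>

lemma avoiders_last_max:
  "{\<sigma> \<in> avoiders (Suc n) [3, 1, 2] [1, 3, 2]. \<sigma> (Suc n) = Suc n} = avoiders n [3, 1, 2] [1, 3, 2]"
proof -
  have perm: "\<sigma> permutes {1..Suc n} \<and> \<sigma> (Suc n) = Suc n \<longleftrightarrow> \<sigma> permutes {1..n}" for \<sigma>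
  proof
    assume "\<sigma> permutes {1..Suc n} \<and> \<sigma> (Suc n) = Suc n"
    then show "\<sigma> permutes {1..n}"
      by (elim conjE permutes_superset) (auto simp: le_Suc_eq)
  next
    assume "\<sigma> permutes {1..n}"
    then show "\<sigma> permutes {1..Suc n} \<and> \<sigma> (Suc n) = Suc n"
      using permutes_not_in[of \<sigma> "{1..n}" "Suc n"] permutes_subset[of \<sigma> "{1..n}" "{1..Suc n}"]
      by auto
  qed
  \<comment> \<open>Both patterns end in 2, a role that the maximal last letter cannot play.\<close>
  have "contains_pattern (Suc n) \<sigma> \<tau> \<longleftrightarrow> contains_pattern n \<sigma> \<tau>"
    if p: "\<sigma> permutes {1..n}" and t: "\<tau> \<in> {[3, 1, 2], [1, 3, 2]}" for \<sigma> \<tau>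
  proof -
    have c: "\<sigma> (Suc n) = Suc n" "\<not> Suc n < \<sigma> i" if "i < Suc n" for i
      using that permutes_le_iff(2)[OF p, of i] permutes_not_in[OF p, of "Suc n"] by auto
    have "\<tau> = [3, 1, 2] \<or> \<tau> = [1, 3, 2]" using t by simp
    then show ?thesis
    proof
      assume t: "\<tau> = [3, 1, 2]"
      show ?thesis unfolding t contains_simps
        by (intro ex_cong1) (use c in \<open>auto simp: le_Suc_eq\<close>)
    next
      assume t: "\<tau> = [1, 3, 2]"
      show ?thesis unfolding t contains_simps
        by (intro ex_cong1) (use c in \<open>auto simp: le_Suc_eq\<close>)
    qed
  qed
  then show ?thesis
    using perm unfolding avoiders_def by blast
qed

text \<open>A crossing with the new fixed point as its later position would need a value above
  \<open>n + 1\<close> or an earlier position i with \<open>n + 1\<close> \<le> i.\<close>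

lemma cr_Suc_fixpoint:
  assumes "\<sigma> permutes {1..n}"
  shows "cr (Suc n) \<sigma> = cr n \<sigma>"
proof -
  have "\<sigma> (Suc n) = Suc n"
    using permutes_not_in[OF assms] by simp
  moreover have "\<sigma> i \<le> n \<longleftrightarrow> i \<le> n" for i
    by (rule permutes_le_iff(2)[OF assms])
  ultimately have "crossings (Suc n) \<sigma> = crossings n \<sigma>"
    unfolding crossings_def by (fastforce simp: le_Suc_eq)
  then show ?thesis
    by (simp add: cr_def)
qed

lemma avoiders_last:
  assumes "\<sigma> \<in> avoiders (Suc n) [3, 1, 2] [1, 3, 2]"
  shows "\<sigma> (Suc n) = 1 \<or> \<sigma> (Suc n) = Suc n"
proof (rule ccontr)
  assume not: "\<not> ?thesis"
  from assms have p: "\<sigma> permutes {1..Suc n}"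
    and a: "\<not> contains_pattern (Suc n) \<sigma> [3, 1, 2]" "\<not> contains_pattern (Suc n) \<sigma> [1, 3, 2]"
    by (auto simp: avoiders_def)
  define i j where "i = inv \<sigma> 1" and "j = inv \<sigma> (Suc n)"
  have v: "\<sigma> i = 1" "\<sigma> j = Suc n"
    by (simp_all add: i_def j_def permutes_inverses[OF p])
  have last: "1 < \<sigma> (Suc n)" "\<sigma> (Suc n) < Suc n"
    using permutes_in_image[OF p, of "Suc n"] not by auto
  have "i \<noteq> Suc n" "j \<noteq> Suc n"
    using v last by auto
  moreover have "i \<in> {1..Suc n}" "j \<in> {1..Suc n}"
    using v permutes_in_image[OF p, of i] permutes_in_image[OF p, of j] by auto
  ultimately have ij: "1 \<le> i" "1 \<le> j" "i < Suc n" "j < Suc n" by auto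
  have "i \<noteq> j" using v last by auto
  \<comment> \<open>The letters 1 and \<open>n + 1\<close> precede the last letter; their order
    decides which forbidden pattern the three form.\<close>
  then consider "i < j" | "j < i" by linarith
  then show False
  proof cases
    case 1
    then have "contains_pattern (Suc n) \<sigma> [1, 3, 2]"
      unfolding contains_132 using ij v last
      by (intro exI[of _ i] exI[of _ j] exI[of _ "Suc n"]) simp
    then show False using a by blast
  next
    case 2
    then have "contains_pattern (Suc n) \<sigma> [3, 1, 2]"
      unfolding contains_312 using ij v last
      by (intro exI[of _ j] exI[of _ i] exI[of _ "Suc n"]) simp
    then show False using a by blast
  qed
qed

lemma crossing_poly_312_132_Suc:
  "crossing_poly (Suc n) [3, 1, 2] [1, 3, 2] =
    crossing_poly n [2, 3, 1] [1, 3, 2] + (if n = 0 then 0 else crossing_poly n [3, 1, 2] [1, 3, 2])"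
proof -
  let ?A = "\<lambda>n. avoiders n [3, 1, 2] [1, 3, 2]"
  let ?f = "\<lambda>\<sigma>. monom 1 (cr (Suc n) \<sigma>) :: int poly"
  have inj: "inj_on (\<lambda>\<pi>. cyc n \<circ> \<pi>) (?A n)"
    using permutes_inj[OF cyc_permutes[of n]] by (auto simp: inj_on_def fun_eq_iff)
  have "sum ?f ((\<lambda>\<pi>. cyc n \<circ> \<pi>) ` ?A n) = crossing_poly n [2, 3, 1] [1, 3, 2]"
    unfolding crossing_poly_231_132_inv sum.reindex[OF inj]
    by (intro sum.cong refl) (simp add: cr_cyc[unfolded comp_def] avoiders_def comp_def)
  then have first: "sum ?f {\<sigma> \<in> ?A (Suc n). \<sigma> (Suc n) = 1} = crossing_poly n [2, 3, 1] [1, 3, 2]"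
    by (simp only: avoiders_cyc)
  have last: "sum ?f (?A n) = crossing_poly n [3, 1, 2] [1, 3, 2]"
    unfolding crossing_poly_def
    by (intro sum.cong refl) (simp add: cr_Suc_fixpoint avoiders_def)
  \<comment> \<open>For \<open>n = 0\<close> the smallest and the largest letter coincide; the
    single permutation is counted under last letter 1 only.\<close>
  have "\<sigma> (Suc n) \<noteq> 1 \<longleftrightarrow> n \<noteq> 0 \<and> \<sigma> (Suc n) = Suc n" if "\<sigma> \<in> ?A (Suc n)" for \<sigma>
    using avoiders_last[OF that] by (cases n) auto
  then have "{\<sigma> \<in> ?A (Suc n). \<sigma> (Suc n) \<noteq> 1} = (if n = 0 then {} else {\<sigma> \<in> ?A (Suc n). \<sigma> (Suc n) = Suc n})"
    by (cases "n = 0") (simp_all cong: conj_cong)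
  then have rest: "{\<sigma> \<in> ?A (Suc n). \<sigma> (Suc n) \<noteq> 1} = (if n = 0 then {} else ?A n)"
    by (simp only: avoiders_last_max)
  have split: "?A (Suc n) = {\<sigma> \<in> ?A (Suc n). \<sigma> (Suc n) = 1} \<union> {\<sigma> \<in> ?A (Suc n). \<sigma> (Suc n) \<noteq> 1}"
    by auto
  have "crossing_poly (Suc n) [3, 1, 2] [1, 3, 2] =
      sum ?f {\<sigma> \<in> ?A (Suc n). \<sigma> (Suc n) = 1} + sum ?f {\<sigma> \<in> ?A (Suc n). \<sigma> (Suc n) \<noteq> 1}"
    unfolding crossing_poly_def by (subst split, rule sum.union_disjoint) auto
  then show ?thesis
    unfolding rest first using last by auto
qed

text \<open>The empty pattern occurs in every permutation, hence the nonemptiness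
  hypotheses.\<close>

lemma crossing_poly_0:
  assumes "\<tau>\<^sub>1 \<noteq> []" "\<tau>\<^sub>2 \<noteq> []"
  shows "crossing_poly 0 \<tau>\<^sub>1 \<tau>\<^sub>2 = 1"
proof -
  have "\<not> contains_pattern 0 \<sigma> \<tau>" if "\<tau> \<noteq> []" for \<sigma> \<tau>
    using that by (auto simp: contains_pattern_def)
  then have "avoiders 0 \<tau>\<^sub>1 \<tau>\<^sub>2 = {id}"
    using assms by (auto simp: avoiders_def)
  moreover have "cr 0 id = 0"
    by (simp add: cr_def crossings_def)
  ultimately show ?thesis
    by (simp add: crossing_poly_def)
qed

subsection \<open>The reverse-complement-inverse\<close>

definition rc :: "nat \<Rightarrow> nat \<Rightarrow> nat" where
  "rc n i = (if i \<in> {1..n} then Suc n - i else i)"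

lemma rc_rc [simp]: "rc n (rc n i) = i"
  by (auto simp: rc_def)

lemma rc_permutes: "rc n permutes {1..n}"
  by (rule inj_imp_permutes) (auto simp: inj_on_def rc_def)

lemma rc_less_iff:
  assumes "i \<in> {1..n}" "j \<in> {1..n}"
  shows "rc n i < rc n j \<longleftrightarrow> j < i" "rc n i \<le> rc n j \<longleftrightarrow> j \<le> i"
  using assms by (auto simp: rc_def)

text \<open>Conjugation by \<open>rc n\<close> is the reverse-complement. Together with inversion it
  reflects the diagram of \<sigma> in its antidiagonal.\<close>

definition rci :: "nat \<Rightarrow> (nat \<Rightarrow> nat) \<Rightarrow> nat \<Rightarrow> nat" where
  "rci n \<sigma> = rc n \<circ> inv \<sigma> \<circ> rc n"

lemma rci_permutes:
  assumes "\<sigma> permutes {1..n}"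
  shows "rci n \<sigma> permutes {1..n}"
  unfolding rci_def by (intro permutes_compose permutes_inv rc_permutes assms)

text \<open>The point (i, \<sigma> i) of the diagram moves to (\<open>rc n (\<sigma> i)\<close>,
  \<open>rc n i\<close>). In this form no inverse has to be evaluated.\<close>

lemma rci_apply:
  assumes "\<sigma> permutes {1..n}"
  shows "rci n \<sigma> (rc n (\<sigma> i)) = rc n i"
  by (simp add: rci_def permutes_inverses[OF assms])

lemma rci_rci:
  assumes "\<sigma> permutes {1..n}"
  shows "rci n (rci n \<sigma>) = \<sigma>"
proof
  fix i
  \<comment> \<open>The argument on the left is \<open>i\<close>, by another use of
    \<open>rci_apply\<close>.\<close>
  have "rci n (rci n \<sigma>) (rc n (rci n \<sigma> (rc n (\<sigma> i)))) = \<sigma> i"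
    by (subst rci_apply[OF rci_permutes[OF assms]]) simp
  then show "rci n (rci n \<sigma>) i = \<sigma> i"
    by (simp add: rci_apply[OF assms])
qed

text \<open>The reflection reverses all comparisons among positions and values and exchanges their
  roles. With the pair swapped, upper crossings stay upper and lower ones stay lower, weak
  inequality included. This gives an injection, hence one inequality; the involution gives the
  other.\<close>

lemma cr_rci:
  assumes "\<sigma> permutes {1..n}"
  shows "cr n (rci n \<sigma>) = cr n \<sigma>"
proof -
  have im: "(\<lambda>(i, j). (rc n (\<sigma> j), rc n (\<sigma> i))) ` crossings n \<sigma> \<subseteq> crossings n (rci n \<sigma>)"
    if "\<sigma> permutes {1..n}" for \<sigma>
  proof -
    have "(rc n (\<sigma> j), rc n (\<sigma> i)) \<in> crossings n (rci n \<sigma>)"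
      if "(i, j) \<in> crossings n \<sigma>" for i j
    proof -
      have "i \<in> {1..n}" "j \<in> {1..n}"
        using that by (auto simp: crossings_def)
      moreover from this have "\<sigma> i \<in> {1..n}" "\<sigma> j \<in> {1..n}"
        using permutes_in_image[OF \<open>\<sigma> permutes {1..n}\<close>] by blast+
      moreover have "rc n x \<in> {1..n}" if "x \<in> {1..n}" for x
        using permutes_in_image[OF rc_permutes] that by blast
      ultimately show ?thesis
        using that unfolding crossings_def
        by (auto simp: rci_apply[OF \<open>\<sigma> permutes {1..n}\<close>] rc_less_iff simp del: atLeastAtMost_iff)
    qed
    then show ?thesis by auto
  qed
  have fin: "finite (crossings n \<sigma>)" for \<sigma>
    by (rule finite_subset[of _ "{1..n} \<times> {1..n}"]) (auto simp: crossings_def)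
  have le: "cr n \<sigma> \<le> cr n (rci n \<sigma>)" if "\<sigma> permutes {1..n}" for \<sigma>
    unfolding cr_def
  proof (rule card_inj_on_le[OF _ im[OF that] fin])
    have "x = y" if "rc n (\<sigma> x) = rc n (\<sigma> y)" for x y
      using that permutes_inj[OF rc_permutes] permutes_inj[OF \<open>\<sigma> permutes {1..n}\<close>]
      by (auto dest: injD)
    then show "inj_on (\<lambda>(i, j). (rc n (\<sigma> j), rc n (\<sigma> i))) (crossings n \<sigma>)"
      by (auto simp: inj_on_def)
  qed
  show ?thesis
    using le[OF assms] le[OF rci_permutes[OF assms]] rci_rci[OF assms] by simp
qed

text \<open>A triple of positions \<open>i < j < k\<close> of \<open>\<sigma>\<close> becomes a triple of values of \<open>rci n \<sigma>\<close>,
  in decreasing order.\<close>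

lemma contains_rci_imp:
  assumes "\<sigma> permutes {1..n}"
  shows "contains_pattern n \<sigma> [3, 1, 2] \<Longrightarrow> contains_pattern n (rci n \<sigma>) [3, 1, 2]"
    and "contains_pattern n \<sigma> [2, 3, 1] \<Longrightarrow> contains_pattern n (rci n \<sigma>) [2, 3, 1]"
    and "contains_pattern n \<sigma> [1, 3, 2] \<Longrightarrow> contains_pattern n (rci n \<sigma>) [2, 1, 3]"
    and "contains_pattern n \<sigma> [2, 1, 3] \<Longrightarrow> contains_pattern n (rci n \<sigma>) [1, 3, 2]"
proof -
  \<comment> \<open>\<open>p i\<close> is the position in \<rho> of the reflected point of
    \<open>i\<close>, whose value there is \<open>rc n i\<close>. The witnesses below therefore list
    the positions of \<sigma> by decreasing value.\<close>
  define \<rho> p where "\<rho> = rci n \<sigma>" and "p = (\<lambda>i. rc n (\<sigma> i))"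
  have vals: "\<rho> (p i) < \<rho> (p j) \<longleftrightarrow> j < i" if "i \<in> {1..n}" "j \<in> {1..n}" for i j
    using that by (simp add: \<rho>_def p_def rci_apply[OF assms] rc_less_iff del: atLeastAtMost_iff)
  have positions: "p i < p j \<longleftrightarrow> \<sigma> j < \<sigma> i" if "i \<in> {1..n}" "j \<in> {1..n}" for i j
  proof -
    have "\<sigma> i \<in> {1..n}" "\<sigma> j \<in> {1..n}"
      using that permutes_in_image[OF assms] by blast+
    then show ?thesis by (simp only: p_def rc_less_iff)
  qed
  have bounds: "Suc 0 \<le> p i \<longleftrightarrow> Suc 0 \<le> i" "p i \<le> n \<longleftrightarrow> i \<le> n" for i
    by (simp_all only: p_def permutes_le_iff[OF rc_permutes] permutes_le_iff[OF assms])
  note simps = vals positions bounds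
  show "contains_pattern n (rci n \<sigma>) [3, 1, 2]" if c: "contains_pattern n \<sigma> [3, 1, 2]"
  proof -
    obtain i j k where "1 \<le> i" "i < j" "j < k" "k \<le> n" "\<sigma> j < \<sigma> k" "\<sigma> k < \<sigma> i"
      using c unfolding contains_simps by blast
    then show ?thesis unfolding contains_simps \<rho>_def[symmetric]
      by (intro exI[of _ "p i"] exI[of _ "p k"] exI[of _ "p j"]) (simp add: simps)
  qed
  show "contains_pattern n (rci n \<sigma>) [2, 3, 1]" if c: "contains_pattern n \<sigma> [2, 3, 1]"
  proof -
    obtain i j k where "1 \<le> i" "i < j" "j < k" "k \<le> n" "\<sigma> k < \<sigma> i" "\<sigma> i < \<sigma> j"
      using c unfolding contains_simps by blast
    then show ?thesis unfolding contains_simps \<rho>_def[symmetric]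
      by (intro exI[of _ "p j"] exI[of _ "p i"] exI[of _ "p k"]) (simp add: simps)
  qed
  show "contains_pattern n (rci n \<sigma>) [2, 1, 3]" if c: "contains_pattern n \<sigma> [1, 3, 2]"
  proof -
    obtain i j k where "1 \<le> i" "i < j" "j < k" "k \<le> n" "\<sigma> i < \<sigma> k" "\<sigma> k < \<sigma> j"
      using c unfolding contains_simps by blast
    then show ?thesis unfolding contains_simps \<rho>_def[symmetric]
      by (intro exI[of _ "p j"] exI[of _ "p k"] exI[of _ "p i"]) (simp add: simps)
  qed
  show "contains_pattern n (rci n \<sigma>) [1, 3, 2]" if c: "contains_pattern n \<sigma> [2, 1, 3]"
  proof -
    obtain i j k where "1 \<le> i" "i < j" "j < k" "k \<le> n" "\<sigma> j < \<sigma> i" "\<sigma> i < \<sigma> k"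
      using c unfolding contains_simps by blast
    then show ?thesis unfolding contains_simps \<rho>_def[symmetric]
      by (intro exI[of _ "p k"] exI[of _ "p i"] exI[of _ "p j"]) (simp add: simps)
  qed
qed

lemma crossing_poly_213_eq_132:
  assumes "\<tau> \<in> {[3, 1, 2], [2, 3, 1]}"
  shows "crossing_poly n \<tau> [2, 1, 3] = crossing_poly n \<tau> [1, 3, 2]"
  unfolding crossing_poly_def
proof (rule sum.reindex_bij_witness[of _ "rci n" "rci n"])
  \<comment> \<open>Applied to \<open>rci n \<sigma>\<close>, the transport of patterns leads back
    to \<sigma> by involutivity.\<close>
  have imp: "contains_pattern n \<sigma> \<tau> \<or> contains_pattern n \<sigma> [1, 3, 2]"
    if "\<sigma> permutes {1..n}" "contains_pattern n (rci n \<sigma>) \<tau> \<or> contains_pattern n (rci n \<sigma>) [2, 1, 3]" for \<sigma>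
    using that assms contains_rci_imp[OF rci_permutes[OF that(1)]] rci_rci[OF that(1)] by auto
  have imp': "contains_pattern n \<sigma> \<tau> \<or> contains_pattern n \<sigma> [2, 1, 3]"
    if "\<sigma> permutes {1..n}" "contains_pattern n (rci n \<sigma>) \<tau> \<or> contains_pattern n (rci n \<sigma>) [1, 3, 2]" for \<sigma>
    using that assms contains_rci_imp[OF rci_permutes[OF that(1)]] rci_rci[OF that(1)] by auto
  show "rci n \<sigma> \<in> avoiders n \<tau> [2, 1, 3]" if "\<sigma> \<in> avoiders n \<tau> [1, 3, 2]" for \<sigma>
    using that imp[of \<sigma>] rci_permutes by (auto simp: avoiders_def)
  show "rci n \<sigma> \<in> avoiders n \<tau> [1, 3, 2]" if "\<sigma> \<in> avoiders n \<tau> [2, 1, 3]" for \<sigma>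
    using that imp'[of \<sigma>] rci_permutes by (auto simp: avoiders_def)
qed (auto simp: avoiders_def rci_rci cr_rci)

section \<open>From the recurrence to generating functions\<close>

theorem mainTheorem5:
  fixes \<tau> \<tau>' :: "nat list"
  assumes "(\<tau>, \<tau>') \<in> {[1,3,2], [2,1,3]} \<times> {[1,3,2], [2,1,3]}"
  shows "crossing_gf [3,1,2] \<tau> = 1 + (fps_X / (1 - fps_X)) * crossing_gf [2,3,1] \<tau>'"
proof -
  let ?A = "crossing_gf [3,1,2] [1,3,2]" and ?B = "crossing_gf [2,3,1] [1,3,2]"
  have sym: "crossing_gf [3,1,2] \<tau> = ?A" "crossing_gf [2,3,1] \<tau>' = ?B"
    using assms by (auto simp: crossing_gf_def crossing_poly_213_eq_132 simp del: One_nat_def)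
  \<comment> \<open>Subtracting 1 removes the constant coefficient of \<open>?A\<close>, which is
    why coefficient 1 reads \<open>a\<^sub>1 = b\<^sub>0\<close> and the recurrence with its
    exception at \<open>n = 0\<close> becomes one equation.\<close>
  have eq: "(1 - fps_X) * (?A - 1) = fps_X * ?B"
  proof (rule fps_ext)
    fix n
    show "fps_nth ((1 - fps_X) * (?A - 1)) n = fps_nth (fps_X * ?B) n"
    proof (cases n)
      case 0
      then show ?thesis by (simp add: crossing_gf_def crossing_poly_0)
    next
      case (Suc m)
      then show ?thesis
        by (cases m)
          (simp_all add: left_diff_distrib crossing_gf_def crossing_poly_0 crossing_poly_312_132_Suc
              del: One_nat_def)
    qed
  qed
  \<comment> \<open>A nonzero constant term over a field makes 1 - z invertible, so the quotient is
    multiplication by its inverse.\<close>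
  have unit: "fps_nth (1 - fps_X :: int poly fract fps) 0 \<noteq> 0"
    by simp
  have "?A - 1 = inverse (1 - fps_X) * (1 - fps_X) * (?A - 1)"
    by (simp only: inverse_mult_eq_1[OF unit] mult_1_left)
  also have "\<dots> = (fps_X / (1 - fps_X)) * ?B"
    by (simp only: mult.assoc eq fps_divide_unit[OF unit] mult.left_commute)
  finally have "?A = 1 + (fps_X / (1 - fps_X)) * ?B"
    by (simp only: diff_eq_eq add.commute)
  then show ?thesis
    by (simp only: sym)
qed

end
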